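(* Let $(P_n)_{n\geq 1}$ be a renewal covering of the natural numbers. Then $$\frac{P_n}{n\ln n}\longrightarrow 1 \quad\text{almost surely as } n\to\infty .$$
   Context: $\mathbb{N}=\{1,2,\dots\}$. $\mathrm{Geo}(p)$ denotes a geometric random variable with $\mathbb{P}(\mathrm{Geo}(p)=k)=(1-p)^{k-1}p$ for $k\in\{1,2,\dots\}$. A renewal covering of the natural numbers is the random sequence $(P_n)_{n\geq1}$ of natural numbers defined inductively as follows: $P_1=2$ almost surely, and for each $n\geq 1$, $P_{n+1}=P_n+\mathrm{Geo}\left(\prod_{k=1}^{n}\left(1-\frac{1}{P_k}\right)\right)$, where this means that, for every $j\ge 1$ and every increasing sequence of naturals $a_1<\dots<a_n$ with $\mathbb{P}(P_1=a_1,\dots,P_n=a_n)>0$, $$\mathbb{P}\left(P_{n+1}-P_n=j \mid P_1=a_1,\dots,P_n=a_n\right)=\mathbb{P}\left(\mathrm{Geo}\left(\prod_{k=1}^{n}\left(1-\tfrac{1}{a_k}\right)\right)=j\right).$$ *)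

theory Defs
  imports "HOL-Probability.Probability"
begin

text \<open>
  The library's \<^const>\<open>geometric_pmf\<close> counts failures and lives on \<open>{0, 1, ...}\<close>;
  here the geometric distribution counts trials and lives on \<open>{1, 2, ...}\<close>.
\<close>
definition geo_pmf :: "real \<Rightarrow> nat pmf" where
  "geo_pmf p = map_pmf Suc (geometric_pmf p)"

lemma pmf_geo_pmf:
  assumes "0 < p" "p \<le> 1" "1 \<le> k"
  shows "pmf (geo_pmf p) k = (1 - p) ^ (k - 1) * p"
proof -
  have "pmf (geo_pmf p) (Suc (k - 1)) = pmf (geometric_pmf p) (k - 1)"
    unfolding geo_pmf_def by (rule pmf_map_inj') simp
  with assms show ?thesis by simp
qed

text \<open>
  The process is indexed by \<open>n \<ge> 1\<close>; the value \<open>P 0\<close> is unconstrained and plays no role.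
  A conditioning history of positive probability has \<open>a 1 = 2\<close> and is strictly increasing, so the
  parameter passed to \<^const>\<open>geo_pmf\<close> lies in the interval \<open>(0, 1/2]\<close>.
  The increment is taken in the integers, to avoid truncated subtraction.
\<close>
locale renewal_covering = prob_space M
  for M :: "'a measure" and P :: "nat \<Rightarrow> 'a \<Rightarrow> nat" +
  assumes random_variable_P: "n \<ge> 1 \<Longrightarrow> random_variable (count_space {1..}) (P n)"
    and P_1: "AE \<omega> in M. P 1 \<omega> = 2"
    and cond_prob_increment:
      "n \<ge> 1 \<Longrightarrow> j \<ge> 1 \<Longrightarrow> (\<forall>k\<in>{1..n}. a k \<ge> 1) \<Longrightarrow> strict_mono_on {1..n} a \<Longrightarrow>
       \<P>(\<omega> in M. \<forall>k\<in>{1..n}. P k \<omega> = a k) > 0 \<Longrightarrow>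
       \<P>(\<omega> in M. int (P (n + 1) \<omega>) - int (P n \<omega>) = int j \<bar> \<forall>k\<in>{1..n}. P k \<omega> = a k) =
       pmf (geo_pmf (\<Prod>k=1..n. 1 - 1 / real (a k))) j"

end

theory Submission
  imports Defs "HOL-Real_Asymp.Real_Asymp"
begin

text \<open>
  Read the process as a random sieve: let \<open>C\<^sub>m\<close> be the set of hit integers in \<open>{2..m + 1}\<close> and
  \<open>X\<^sub>m\<close> the product of \<open>1 - 1 / k\<close> over \<open>k \<in> C\<^sub>m\<close>. Since geometric gaps are memoryless, given \<open>C\<^sub>m\<close>
  the integer \<open>m + 2\<close> is hit with probability \<open>X\<^sub>m\<close>. Hence \<open>1 / X\<^sub>m - (1 + harm m)\<close> and
  \<open>card C\<^sub>m - (\<Sum>i<m. X\<^sub>i)\<close> are martingales, with second moments at most \<open>2\<close> and \<open>m\<close>.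
  Summing second moments along \<open>m = 2 ^ k\<close> and \<open>m = k ^ 4\<close> respectively, and interpolating by
  monotonicity, gives \<open>1 / X\<^sub>m \<sim> ln m\<close> and then \<open>card C\<^sub>m \<sim> m / ln m\<close> almost surely. Inverting the
  counting function at the hit points yields \<open>P\<^sub>n \<sim> n ln n\<close>.
\<close>

section \<open>Real sequences\<close>

text \<open>Subtracting \<open>L * b\<close> reduces to limit 0: past some \<open>N\<close> the
  increments of \<open>d\<close> are at most \<open>e / 2\<close> times those of \<open>b\<close>.
  Telescoping keeps this up to a constant, which the divergence of \<open>b\<close> absorbs.\<close>

lemma stolz_cesaro:
  fixes a b :: "nat \<Rightarrow> real"
  assumes incr: "eventually (\<lambda>n. b n < b (Suc n)) sequentially"
    and top: "filterlim b at_top sequentially"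
    and lim: "(\<lambda>n. (a (Suc n) - a n) / (b (Suc n) - b n)) \<longlonglongrightarrow> L"
  shows "(\<lambda>n. a n / b n) \<longlonglongrightarrow> L"
proof -
  define d where "d n = a n - L * b n" for n
  have "(\<lambda>n. d n / b n) \<longlonglongrightarrow> 0"
  proof (rule tendstoI)
    fix e :: real assume e: "0 < e"
    have "eventually (\<lambda>n. \<bar>(a (Suc n) - a n) / (b (Suc n) - b n) - L\<bar> < e / 2) sequentially"
      using tendstoD[OF lim, of "e / 2"] e by (simp add: dist_real_def)
    with incr have "eventually (\<lambda>n. \<bar>d (Suc n) - d n\<bar> \<le> e / 2 * (b (Suc n) - b n)) sequentially"
    proof eventually_elim
      case (elim n)
      have "d (Suc n) - d n = ((a (Suc n) - a n) / (b (Suc n) - b n) - L) * (b (Suc n) - b n)"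
        using elim by (simp add: d_def field_simps)
      with elim show ?case by (simp add: abs_mult mult_right_mono)
    qed
    then obtain N where N: "\<And>n. n \<ge> N \<Longrightarrow> \<bar>d (Suc n) - d n\<bar> \<le> e / 2 * (b (Suc n) - b n)"
      unfolding eventually_sequentially by blast
    have bound: "\<bar>d n - d N\<bar> \<le> e / 2 * (b n - b N)" if "n \<ge> N" for n
      using that
    proof (induction n rule: dec_induct)
      case (step n)
      have "\<bar>d (Suc n) - d N\<bar> \<le> \<bar>d (Suc n) - d n\<bar> + \<bar>d n - d N\<bar>" by simp
      with step N[of n] show ?case by (simp add: algebra_simps)
    qed simp
    \<comment> \<open>The constant \<open>c\<close> collects everything frozen at \<open>N\<close>;
      once \<open>b n\<close> exceeds \<open>2 * c / e\<close>, it costs less than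
      \<open>e / 2 * b n\<close>. The extra 1 in the threshold forces
      \<open>b n > 0\<close>.\<close>
    define c where "c = \<bar>d N\<bar> + e / 2 * \<bar>b N\<bar>"
    have "eventually (\<lambda>n. b n > 2 * c / e + 1) sequentially"
      using top by (simp add: filterlim_at_top_dense)
    with eventually_ge_at_top[of N] show "eventually (\<lambda>n. dist (d n / b n) 0 < e) sequentially"
    proof eventually_elim
      case (elim n)
      have "2 * c / e \<ge> 0" using e by (simp add: c_def)
      with elim have pos: "b n > 0" by linarith
      have "- (e / 2 * b N) \<le> e / 2 * \<bar>b N\<bar>"
        using e by (metis abs_ge_minus_self abs_mult abs_of_pos half_gt_zero)
      have "\<bar>d n\<bar> \<le> \<bar>d N\<bar> + \<bar>d n - d N\<bar>" by simp
      also have "\<dots> \<le> \<bar>d N\<bar> + e / 2 * (b n - b N)" using bound elim by simp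
      also have "\<dots> \<le> c + e / 2 * b n"
        using \<open>- (e / 2 * b N) \<le> e / 2 * \<bar>b N\<bar>\<close> by (simp add: c_def right_diff_distrib)
      also have "\<dots> < e * b n"
        using elim(2) e by (simp add: field_simps)
      finally show ?case using pos by (simp add: field_simps)
    qed
  qed
  then have "(\<lambda>n. d n / b n + L) \<longlonglongrightarrow> 0 + L" by (intro tendsto_intros)
  moreover have "eventually (\<lambda>n. d n / b n + L = a n / b n) sequentially"
  proof -
    have "eventually (\<lambda>n. b n > 0) sequentially"
      using top by (simp add: filterlim_at_top_dense)
    then show ?thesis by eventually_elim (simp add: d_def field_simps)
  qed
  ultimately show ?thesis by (simp add: filterlim_cong)
qed

text \<open>Between consecutive sample points, monotonicity traps \<open>f n / g n\<close> between
  the quotients with numerator and denominator taken at opposite ends of the block. Since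
  \<open>g\<close> barely changes across a block, both tend to 1.\<close>

lemma mono_ratio_tendsto_1_of_subseq:
  fixes f g :: "nat \<Rightarrow> real" and s :: "nat \<Rightarrow> nat"
  assumes f: "mono f" "\<And>n. 0 \<le> f n"
    and g: "eventually (\<lambda>n. 0 < g n \<and> g n \<le> g (Suc n)) sequentially"
    and s: "strict_mono s"
    and lim: "(\<lambda>k. f (s k) / g (s k)) \<longlonglongrightarrow> 1"
    and ratio: "(\<lambda>k. g (s (Suc k)) / g (s k)) \<longlonglongrightarrow> 1"
  shows "(\<lambda>n. f n / g n) \<longlonglongrightarrow> 1"
proof -
  obtain N where N: "\<And>n. n \<ge> N \<Longrightarrow> 0 < g n \<and> g n \<le> g (Suc n)"
    using g unfolding eventually_sequentially by blast
  have g_mono: "g m \<le> g n" if "N \<le> m" "m \<le> n" for m n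
    using that(2,1) by (induction n rule: dec_induct) (use N in \<open>auto intro: order_trans\<close>)
  have sk: "k \<le> s k" for k using s by (simp add: strict_mono_imp_increasing)
  have evs: "eventually (\<lambda>k. 0 < g (s k) \<and> 0 < g (s (Suc k))) sequentially"
    using eventually_ge_at_top[of N]
    by eventually_elim (meson N sk le_SucI order_trans)
  have lo: "(\<lambda>k. f (s k) / g (s (Suc k))) \<longlonglongrightarrow> 1"
  proof -
    have "(\<lambda>k. (f (s k) / g (s k)) / (g (s (Suc k)) / g (s k))) \<longlonglongrightarrow> 1 / 1"
      by (intro tendsto_divide lim ratio) simp
    moreover have "eventually (\<lambda>k. (f (s k) / g (s k)) / (g (s (Suc k)) / g (s k))
        = f (s k) / g (s (Suc k))) sequentially"
      using evs by eventually_elim simp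
    ultimately show ?thesis unfolding div_by_1 by (rule Lim_transform_eventually)
  qed
  have hi: "(\<lambda>k. f (s (Suc k)) / g (s k)) \<longlonglongrightarrow> 1"
  proof -
    have "(\<lambda>k. (f (s (Suc k)) / g (s (Suc k))) * (g (s (Suc k)) / g (s k))) \<longlonglongrightarrow> 1 * 1"
      by (intro tendsto_mult ratio LIMSEQ_Suc[OF lim])
    moreover have "eventually (\<lambda>k. (f (s (Suc k)) / g (s (Suc k))) * (g (s (Suc k)) / g (s k))
        = f (s (Suc k)) / g (s k)) sequentially"
      using evs by eventually_elim simp
    ultimately show ?thesis unfolding mult_1_right by (rule Lim_transform_eventually)
  qed
  \<comment> \<open>The index of the block containing \<open>n\<close>: the last sample point not
    beyond \<open>n\<close>, provided that \<open>s 0 \<le> n\<close>.\<close>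
  define \<kappa> where "\<kappa> n = (LEAST j. n < s j) - 1" for n
  have \<kappa>: "s (\<kappa> n) \<le> n \<and> n < s (Suc (\<kappa> n))" if "s 0 \<le> n" for n
  proof -
    have ex: "n < s (Suc n)" using sk[of "Suc n"] by simp
    define j where "j = (LEAST j. n < s j)"
    have j: "n < s j" unfolding j_def using ex by (rule LeastI)
    with that have "j \<noteq> 0" by (metis not_le)
    moreover have "\<not> n < s (j - 1)"
      unfolding j_def by (rule not_less_Least) (use \<open>j \<noteq> 0\<close> in \<open>simp add: j_def\<close>)
    ultimately show ?thesis using j by (simp add: \<kappa>_def j_def[symmetric])
  qed
  have \<kappa>_top: "filterlim \<kappa> at_top sequentially"
    unfolding filterlim_at_top
  proof
    fix K
    show "eventually (\<lambda>n. K \<le> \<kappa> n) sequentially"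
      using eventually_ge_at_top[of "s 0"] eventually_ge_at_top[of "s K"]
    proof eventually_elim
      case (elim n)
      with \<kappa>[of n] have "s K < s (Suc (\<kappa> n))" by linarith
      with s show ?case by (simp add: strict_mono_less)
    qed
  qed
  show ?thesis
  proof (rule tendsto_sandwich)
    show "(\<lambda>n. f (s (\<kappa> n)) / g (s (Suc (\<kappa> n)))) \<longlonglongrightarrow> 1"
      by (rule filterlim_compose[OF lo \<kappa>_top])
    show "(\<lambda>n. f (s (Suc (\<kappa> n))) / g (s (\<kappa> n))) \<longlonglongrightarrow> 1"
      by (rule filterlim_compose[OF hi \<kappa>_top])
    have "eventually (\<lambda>n. s 0 \<le> n \<and> N \<le> \<kappa> n) sequentially"
      using \<kappa>_top by (auto simp: filterlim_at_top intro: eventually_conj)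
    then have ev: "eventually (\<lambda>n. f (s (\<kappa> n)) \<le> f n \<and> f n \<le> f (s (Suc (\<kappa> n)))
       \<and> 0 < g (s (\<kappa> n)) \<and> g (s (\<kappa> n)) \<le> g n \<and> g n \<le> g (s (Suc (\<kappa> n)))) sequentially"
    proof eventually_elim
      case (elim n)
      with \<kappa>[of n] sk[of "\<kappa> n"] N[of "s (\<kappa> n)"] show ?case
        by (auto intro!: monoD[OF f(1)] g_mono)
    qed
    show "eventually (\<lambda>n. f (s (\<kappa> n)) / g (s (Suc (\<kappa> n))) \<le> f n / g n) sequentially"
      using ev by eventually_elim (auto intro!: frac_le f)
    show "eventually (\<lambda>n. f n / g n \<le> f (s (Suc (\<kappa> n))) / g (s (\<kappa> n))) sequentially"
      using ev by eventually_elim (auto intro!: frac_le f)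
  qed
qed

text \<open>This inverts \<open>n \<sim> q / ln q\<close>. Taking logarithms gives
  \<open>ln n \<sim> ln q\<close>, because \<open>ln (ln q)\<close> is negligible against
  \<open>ln q\<close>; hence \<open>q \<sim> n ln q \<sim> n ln n\<close>.\<close>

lemma asymp_inverse_div_ln:
  fixes q :: "nat \<Rightarrow> real"
  assumes top: "filterlim q at_top sequentially"
    and lim: "(\<lambda>n. real n * ln (q n) / q n) \<longlonglongrightarrow> 1"
  shows "(\<lambda>n. q n / (real n * ln (real n))) \<longlonglongrightarrow> 1"
proof -
  define r where "r n = real n * ln (q n) / q n" for n
  have r: "r \<longlonglongrightarrow> 1" using lim by (simp add: r_def[abs_def])
  have "((\<lambda>x::real. ln (ln x) / ln x) \<longlongrightarrow> 0) at_top" by real_asymp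
  then have l1: "(\<lambda>n. ln (ln (q n)) / ln (q n)) \<longlonglongrightarrow> 0"
    by (rule filterlim_compose[OF _ top])
  have lnq: "filterlim (\<lambda>n. ln (q n)) at_top sequentially"
    by (rule filterlim_compose[OF ln_at_top top])
  have "(\<lambda>n. ln (r n)) \<longlonglongrightarrow> ln 1" by (intro tendsto_intros r) simp
  then have l2: "(\<lambda>n. ln (r n) / ln (q n)) \<longlonglongrightarrow> 0"
    by (intro real_tendsto_divide_at_top[OF _ lnq]) simp
  have ev: "eventually (\<lambda>n. q n > 1 \<and> r n > 0 \<and> n > 1) sequentially"
    by (intro eventually_conj eventually_gt_at_top order_tendstoD[OF r])
       (use top in \<open>auto simp: filterlim_at_top_dense\<close>)
  have "(\<lambda>n. 1 - ln (ln (q n)) / ln (q n) + ln (r n) / ln (q n)) \<longlonglongrightarrow> 1 - 0 + 0"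
    by (intro tendsto_intros l1 l2)
  moreover have "eventually (\<lambda>n. 1 - ln (ln (q n)) / ln (q n) + ln (r n) / ln (q n)
      = ln (real n) / ln (q n)) sequentially"
    using ev
  proof eventually_elim
    case (elim n)
    then have lpos: "ln (q n) > 0" by simp
    have "ln (r n) = ln (real n) + ln (ln (q n)) - ln (q n)"
      using elim lpos by (simp add: r_def ln_div ln_mult)
    with lpos show ?case by (simp add: field_simps)
  qed
  ultimately have l3: "(\<lambda>n. ln (real n) / ln (q n)) \<longlonglongrightarrow> 1"
    by (simp add: filterlim_cong)
  have "(\<lambda>n. 1 / (r n * (ln (real n) / ln (q n)))) \<longlonglongrightarrow> 1 / (1 * 1)"
    by (intro tendsto_intros r l3) simp
  moreover have "eventually (\<lambda>n. 1 / (r n * (ln (real n) / ln (q n)))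
      = q n / (real n * ln (real n))) sequentially"
    using ev
  proof eventually_elim
    case (elim n)
    then have "ln (q n) > 0" by simp
    with elim show ?case by (simp add: r_def field_simps)
  qed
  ultimately show ?thesis by (simp add: filterlim_cong)
qed

lemma harm_asymp_ln: "(\<lambda>n. (1 + harm n) / ln (real n)) \<longlonglongrightarrow> 1"
proof -
  have "(\<lambda>n. (harm n - ln (real n)) / ln (real n)) \<longlonglongrightarrow> 0"
    by (rule real_tendsto_divide_at_top[OF euler_mascheroni_LIMSEQ]) real_asymp
  moreover have "(\<lambda>n. 1 / ln (real n)) \<longlonglongrightarrow> 0" by real_asymp
  ultimately have "(\<lambda>n. (harm n - ln (real n)) / ln (real n) + 1 / ln (real n) + 1) \<longlonglongrightarrow> 0 + 0 + 1"
    by (intro tendsto_intros)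
  moreover have "eventually (\<lambda>n. (harm n - ln (real n)) / ln (real n) + 1 / ln (real n) + 1
      = (1 + harm n) / ln (real n)) sequentially"
    using eventually_gt_at_top[of 1] by eventually_elim (simp add: field_simps)
  ultimately show ?thesis by (simp add: filterlim_cong)
qed

text \<open>Exchanging sum and integral shows that the series of squares has finite integral, hence
  converges almost everywhere, so its terms tend to 0.\<close>

lemma AE_tendsto_0_of_summable_integral_square:
  fixes f :: "nat \<Rightarrow> 'a \<Rightarrow> real"
  assumes int: "\<And>k. integrable M (\<lambda>x. (f k x)\<^sup>2)"
    and bound: "\<And>k. (\<integral>x. (f k x)\<^sup>2 \<partial>M) \<le> c k" and c: "summable c"
  shows "AE x in M. (\<lambda>k. f k x) \<longlonglongrightarrow> 0"
proof -
  have sum: "summable (\<lambda>k. \<integral>x. (f k x)\<^sup>2 \<partial>M)"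
    by (rule summable_comparison_test'[OF c, of 0]) (use bound in auto)
  have "(\<integral>\<^sup>+x. (\<Sum>k. ennreal ((f k x)\<^sup>2)) \<partial>M) = (\<Sum>k. \<integral>\<^sup>+x. ennreal ((f k x)\<^sup>2) \<partial>M)"
    using int by (intro nn_integral_suminf) auto
  also have "\<dots> = (\<Sum>k. ennreal (\<integral>x. (f k x)\<^sup>2 \<partial>M))"
    using int by (intro suminf_cong nn_integral_eq_integral) auto
  also have "\<dots> = ennreal (\<Sum>k. \<integral>x. (f k x)\<^sup>2 \<partial>M)"
    by (intro suminf_ennreal2 sum) auto
  finally have "(\<integral>\<^sup>+x. (\<Sum>k. ennreal ((f k x)\<^sup>2)) \<partial>M) \<noteq> \<infinity>" by simp
  then have "AE x in M. (\<Sum>k. ennreal ((f k x)\<^sup>2)) \<noteq> \<infinity>"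
    using int by (intro nn_integral_noteq_infinite) auto
  then show ?thesis
  proof eventually_elim
    case (elim x)
    then have "summable (\<lambda>k. (f k x)\<^sup>2)"
      by (intro summable_suminf_not_top) auto
    then have "(\<lambda>k. (f k x)\<^sup>2) \<longlonglongrightarrow> 0" by (rule summable_LIMSEQ_zero)
    then have "(\<lambda>k. sqrt ((f k x)\<^sup>2)) \<longlonglongrightarrow> sqrt 0" by (intro tendsto_intros)
    then show ?case by (simp add: tendsto_rabs_zero_iff)
  qed
qed

text \<open>The function \<open>n / ln n\<close> is the target for the number of hits. The facts
  serve the Stolz-Cesaro argument, the interpolation along fourth powers, and the comparison with
  the fluctuation scale \<open>k ^ 3\<close>.\<close>

lemma div_ln_asymp:
  fixes g :: "nat \<Rightarrow> real"
  defines "g \<equiv> \<lambda>n. real n / ln (real n)"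
  shows "eventually (\<lambda>n. g n < g (Suc n)) sequentially"
    and "eventually (\<lambda>n. 0 < g n) sequentially"
    and "filterlim g at_top sequentially"
    and "(\<lambda>n. ln (real n) * (g (Suc n) - g n)) \<longlonglongrightarrow> 1"
    and "(\<lambda>k. g (Suc k ^ 4) / g (k ^ 4)) \<longlonglongrightarrow> 1"
    and "(\<lambda>k. real k ^ 3 / g (k ^ 4)) \<longlonglongrightarrow> 0"
  unfolding g_def of_nat_Suc of_nat_power by real_asymp+

lemma strict_mono_le_set_eq_lessThan:
  fixes f :: "nat \<Rightarrow> nat"
  assumes "strict_mono f"
  shows "\<exists>n. {i. f i \<le> b} = {..<n}"
proof -
  have "b < f (Suc b)" using strict_mono_imp_increasing[OF assms, of "Suc b"] by simp
  then have n: "b < f (LEAST i. b < f i)" by (rule LeastI)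
  have "f i \<le> b \<longleftrightarrow> i < (LEAST i. b < f i)" for i
    using n not_less_Least[of i "\<lambda>i. b < f i"] strict_mono_less_eq[OF assms]
    by (metis leD leI order_less_le_trans)
  then show ?thesis by blast
qed

text \<open>Prescribing the hits up to \<open>b\<close> thus amounts to prescribing the first
  \<open>n\<close> terms and letting the next one exceed \<open>b\<close>. Equal sets have equal
  cardinality, and a set has only one increasing enumeration.\<close>

lemma strict_mono_image_eq_iff:
  fixes f g :: "nat \<Rightarrow> nat"
  assumes f: "strict_mono f" and g: "strict_mono g" and gset: "{i. g i \<le> b} = {..<n}"
  shows "f ` {i. f i \<le> b} = g ` {i. g i \<le> b} \<longleftrightarrow> (\<forall>k<n. f k = g k) \<and> b < f n"
proof
  assume eq: "f ` {i. f i \<le> b} = g ` {i. g i \<le> b}"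
  obtain n' where fset: "{i. f i \<le> b} = {..<n'}" using strict_mono_le_set_eq_lessThan[OF f] ..
  have "n' = n"
    using arg_cong[OF eq, of card] f g
    by (simp add: fset gset card_image strict_mono_imp_inj_on inj_on_subset[OF _ subset_UNIV])
  have "map f [0..<n] = map g [0..<n]"
    by (rule strict_sorted_equal)
      (use eq f g in \<open>auto simp: sorted_wrt_map sorted_wrt_iff_nth_less strict_mono_less
        fset gset \<open>n' = n\<close> lessThan_atLeast0\<close>)
  moreover have "b < f n" using fset \<open>n' = n\<close> by (metis lessThan_iff less_irrefl mem_Collect_eq not_le)
  ultimately show "(\<forall>k<n. f k = g k) \<and> b < f n" by simp
next
  assume R: "(\<forall>k<n. f k = g k) \<and> b < f n"
  have "f i \<le> b \<longleftrightarrow> i < n" for i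
    using R gset strict_mono_less_eq[OF f]
    by (metis leD leI lessThan_iff mem_Collect_eq order_less_le_trans)
  then show "f ` {i. f i \<le> b} = g ` {i. g i \<le> b}" using R gset by auto
qed

section \<open>The sieve\<close>

text \<open>This is the parameter of the next geometric gap when \<open>S\<close> is the set of hits
  so far.\<close>

definition gap_prob :: "nat set \<Rightarrow> real" where
  "gap_prob S = (\<Prod>k\<in>S. 1 - 1 / real k)"

lemma gap_prob_pos: "S \<subseteq> {2..} \<Longrightarrow> 0 < gap_prob S"
  unfolding gap_prob_def by (intro prod_pos) auto

lemma gap_prob_le_1: "S \<subseteq> {2..} \<Longrightarrow> gap_prob S \<le> 1"
  unfolding gap_prob_def by (intro prod_le_1) auto

lemma gap_prob_insert:
  "finite S \<Longrightarrow> m \<notin> S \<Longrightarrow> gap_prob (insert m S) = gap_prob S * (1 - 1 / real m)"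
  by (simp add: gap_prob_def mult.commute)

lemma gap_prob_antimono:
  assumes "S \<subseteq> T" "T \<subseteq> {2..}" "finite T"
  shows "gap_prob T \<le> gap_prob S"
proof -
  have "gap_prob T = gap_prob (T - S) * gap_prob S"
    unfolding gap_prob_def using assms(1,3) by (rule prod.subset_diff)
  also have "\<dots> \<le> 1 * gap_prob S"
    using assms by (intro mult_right_mono gap_prob_le_1 order.strict_implies_order[OF gap_prob_pos]) auto
  finally show ?thesis by simp
qed

section \<open>Histories and the law of the next hit\<close>

context renewal_covering
begin

text \<open>Indexing from 0 lets \<open>strict_mono\<close> and initial segments
  \<open>{..n}\<close> speak of the whole process.\<close>

definition Q :: "nat \<Rightarrow> 'a \<Rightarrow> nat" where
  "Q k = P (Suc k)"

lemma Q_measurable [measurable]: "Q k \<in> measurable M (count_space UNIV)"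
  unfolding Q_def by (rule measurable_compose[OF random_variable_P]) auto

lemma AE_Q_0: "AE \<omega> in M. Q 0 \<omega> = 2"
  using P_1 by (simp add: Q_def)

definition history :: "nat \<Rightarrow> (nat \<Rightarrow> nat) \<Rightarrow> 'a \<Rightarrow> bool" where
  "history n a \<omega> \<longleftrightarrow> (\<forall>k\<le>n. Q k \<omega> = a k)"

lemma history_measurable [measurable]: "Measurable.pred M (history n a)"
  unfolding history_def by measurable

lemma history_pos_imp:
  assumes "\<P>(\<omega> in M. history n a \<omega>) > 0" "strict_mono_on {..n} a"
  shows "a ` {..n} \<subseteq> {2..}"
proof -
  have "a 0 = 2"
  proof (rule ccontr)
    assume "a 0 \<noteq> 2"
    have "AE \<omega> in M. \<not> history n a \<omega>"
      using AE_Q_0 by eventually_elim (use \<open>a 0 \<noteq> 2\<close> in \<open>auto simp: history_def\<close>)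
    then have "\<P>(\<omega> in M. history n a \<omega>) = 0" by (subst prob_eq_0) auto
    with assms show False by simp
  qed
  moreover have "a 0 \<le> a k" if "k \<le> n" for k
    using that strict_mono_on_leD[OF assms(2), of 0 k] by simp
  ultimately show ?thesis by auto
qed

text \<open>Multiplying out the conditional probability gives a form that also covers null
  histories, where both sides vanish.\<close>

lemma prob_history_next:
  assumes a: "strict_mono_on {..n} a" and j: "1 \<le> j"
  shows "\<P>(\<omega> in M. history n a \<omega> \<and> Q (Suc n) \<omega> = a n + j) =
    \<P>(\<omega> in M. history n a \<omega>) * ((1 - gap_prob (a ` {..n})) ^ (j - 1) * gap_prob (a ` {..n}))"
proof (cases "\<P>(\<omega> in M. history n a \<omega>) > 0")
  case False
  then have 0: "\<P>(\<omega> in M. history n a \<omega>) = 0" using measure_le_0_iff by (metis not_less)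
  have "\<P>(\<omega> in M. history n a \<omega> \<and> Q (Suc n) \<omega> = a n + j) \<le> \<P>(\<omega> in M. history n a \<omega>)"
    by (intro finite_measure_mono) auto
  with 0 show ?thesis using measure_nonneg[of M "{\<omega> \<in> space M. history n a \<omega> \<and> Q (Suc n) \<omega> = a n + j}"] by simp
next
  case True
  \<comment> \<open>The locale conditions on terms numbered from 1, so the history is shifted by
    one.\<close>
  define b where "b k = a (k - 1)" for k
  have ge: "a ` {..n} \<subseteq> {2..}" by (rule history_pos_imp[OF True a])
  have inj: "inj_on a {..n}" by (rule strict_mono_on_imp_inj_on[OF a])
  have all: "(\<forall>k\<in>{1..Suc n}. R k) \<longleftrightarrow> (\<forall>k\<le>n. R (Suc k))" for R
    by (metis One_nat_def Suc_le_D Suc_le_mono atLeastAtMost_iff le_add1 plus_1_eq_Suc)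
  have hist: "(\<forall>k\<in>{1..Suc n}. P k \<omega> = b k) \<longleftrightarrow> history n a \<omega>" for \<omega>
    unfolding all by (simp add: history_def b_def Q_def)
  have prod: "(\<Prod>k=1..Suc n. 1 - 1 / real (b k)) = gap_prob (a ` {..n})"
    by (simp only: gap_prob_def b_def prod.reindex[OF inj] prod.atLeast1_atMost_eq One_nat_def
      lessThan_Suc_atMost comp_def diff_Suc_Suc minus_nat.diff_0)
  have b_ge: "\<forall>k\<in>{1..Suc n}. 1 \<le> b k" using ge unfolding all by (auto simp: b_def)
  have b_mono: "strict_mono_on {1..Suc n} b"
    unfolding b_def by (intro strict_mono_onI strict_mono_onD[OF a]) auto
  have "\<P>(\<omega> in M. int (P (Suc n + 1) \<omega>) - int (P (Suc n) \<omega>) = int j \<bar> history n a \<omega>) =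
       pmf (geo_pmf (gap_prob (a ` {..n}))) j"
    using cond_prob_increment[of "Suc n" j b, OF _ j b_ge b_mono] True unfolding hist prod by simp
  also have "\<dots> = (1 - gap_prob (a ` {..n})) ^ (j - 1) * gap_prob (a ` {..n})"
    using ge j by (intro pmf_geo_pmf gap_prob_pos gap_prob_le_1)
  finally have "\<P>(\<omega> in M. int (P (Suc n + 1) \<omega>) - int (P (Suc n) \<omega>) = int j \<and> history n a \<omega>) =
    \<P>(\<omega> in M. history n a \<omega>) * ((1 - gap_prob (a ` {..n})) ^ (j - 1) * gap_prob (a ` {..n}))"
    using True by (simp add: cond_prob_def field_simps)
  moreover have "(int (P (Suc n + 1) \<omega>) - int (P (Suc n) \<omega>) = int j \<and> history n a \<omega>) \<longleftrightarrow>
     history n a \<omega> \<and> Q (Suc n) \<omega> = a n + j" for \<omega>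
    by (auto simp: history_def Q_def)
  ultimately show ?thesis by simp
qed

text \<open>The geometric tail arises by removing one atom at a time. The event is stated by
  negation because monotonicity of the process is not yet available: it still includes values of
  \<open>Q (Suc n)\<close> up to \<open>a n\<close>.\<close>

lemma prob_history_tail:
  assumes a: "strict_mono_on {..n} a"
  shows "\<P>(\<omega> in M. history n a \<omega> \<and> \<not> (a n < Q (Suc n) \<omega> \<and> Q (Suc n) \<omega> \<le> a n + L)) =
    \<P>(\<omega> in M. history n a \<omega>) * (1 - gap_prob (a ` {..n})) ^ L"
proof (induction L)
  case 0
  then show ?case by (auto intro!: arg_cong[of _ _ prob])
next
  case (Suc L)
  let ?B = "\<lambda>L. {\<omega> \<in> space M. history n a \<omega> \<and> \<not> (a n < Q (Suc n) \<omega> \<and> Q (Suc n) \<omega> \<le> a n + L)}"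
  have "prob (?B (Suc L) \<union> {\<omega> \<in> space M. history n a \<omega> \<and> Q (Suc n) \<omega> = a n + Suc L}) =
    prob (?B (Suc L)) + \<P>(\<omega> in M. history n a \<omega> \<and> Q (Suc n) \<omega> = a n + Suc L)"
    by (intro finite_measure_Union) auto
  also have "?B (Suc L) \<union> {\<omega> \<in> space M. history n a \<omega> \<and> Q (Suc n) \<omega> = a n + Suc L} = ?B L"
    by auto
  finally have "prob (?B (Suc L)) = prob (?B L) - \<P>(\<omega> in M. history n a \<omega> \<and> Q (Suc n) \<omega> = a n + Suc L)"
    by simp
  with Suc prob_history_next[OF a, of "Suc L"] show ?case by (simp add: algebra_simps)
qed

text \<open>The bad event lies in the tail event for every \<open>L\<close>, and the tail
  probabilities decay geometrically to 0.\<close>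

lemma AE_history_increasing:
  assumes a: "strict_mono_on {..n} a"
  shows "AE \<omega> in M. history n a \<omega> \<longrightarrow> a n < Q (Suc n) \<omega>"
proof -
  let ?h = "\<P>(\<omega> in M. history n a \<omega>)" and ?p = "gap_prob (a ` {..n})"
  let ?B = "{\<omega> \<in> space M. history n a \<omega> \<and> \<not> a n < Q (Suc n) \<omega>}"
  have le: "prob ?B \<le> ?h * (1 - ?p) ^ L" for L
    unfolding prob_history_tail[OF a, of L, symmetric] by (intro finite_measure_mono) auto
  have "prob ?B \<le> 0"
  proof (cases "?h > 0")
    case True
    then have "a ` {..n} \<subseteq> {2..}" by (rule history_pos_imp[OF _ a])
    then have "0 < ?p" "?p \<le> 1" by (auto intro: gap_prob_pos gap_prob_le_1)
    then have "(\<lambda>L. ?h * (1 - ?p) ^ L) \<longlonglongrightarrow> ?h * 0"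
      by (intro tendsto_intros LIMSEQ_power_zero) simp
    then show ?thesis using le by (intro LIMSEQ_le_const) auto
  next
    case False
    with le[of 0] show ?thesis by simp
  qed
  then have "prob ?B = 0" by (simp add: measure_le_0_iff)
  then show ?thesis by (subst (asm) prob_eq_0) auto
qed

definition regular :: "'a \<Rightarrow> bool" where
  "regular \<omega> \<longleftrightarrow> Q 0 \<omega> = 2 \<and> strict_mono (\<lambda>i. Q i \<omega>)"

lemma AE_regular: "AE \<omega> in M. regular \<omega>"
proof -
  \<comment> \<open>Histories are coded by lists, a countable type, so that one null set serves all
    of them.\<close>
  have "AE \<omega> in M. \<forall>n. \<forall>l::nat list. strict_mono_on {..n} ((!) l) \<longrightarrow>
      history n ((!) l) \<omega> \<longrightarrow> l ! n < Q (Suc n) \<omega>"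
    unfolding AE_all_countable by (intro allI AE_impI AE_history_increasing)
  with AE_Q_0 show ?thesis
  proof eventually_elim
    case (elim \<omega>)
    have "Q n \<omega> < Q (Suc n) \<omega>" for n
    \<comment> \<open>Strong induction is needed: the previous fact applies only to a history
      already known to be increasing.\<close>
    proof (induction n rule: less_induct)
      case (less n)
      define l where "l = map (\<lambda>i. Q i \<omega>) [0..<Suc n]"
      have l: "l ! k = Q k \<omega>" if "k \<le> n" for k
        using that by (simp add: l_def del: upt_Suc)
      have "Q i \<omega> < Q j \<omega>" if "i < j" "j \<le> n" for i j
        using that
      proof (induction j)
        case (Suc j)
        with less[of j] show ?case by (cases "i = j") auto
      qed simp
      then have "strict_mono_on {..n} ((!) l)" by (auto simp: strict_mono_on_def l)
      with elim have "history n ((!) l) \<omega> \<longrightarrow> l ! n < Q (Suc n) \<omega>" by blast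
      then show ?case by (simp add: history_def l)
    qed
    with elim show ?case by (simp add: regular_def strict_mono_Suc_iff)
  qed
qed

section \<open>The hit set and its transition probabilities\<close>

text \<open>The window holds exactly \<open>m\<close> integers, so passing to \<open>Suc m\<close>
  examines \<open>m + 2\<close>. Cutting off below 2 keeps \<open>gap_prob\<close> positive at every
  point, not only almost surely.\<close>

definition cover :: "nat \<Rightarrow> 'a \<Rightarrow> nat set" where
  "cover m \<omega> = {k \<in> {2..Suc m}. \<exists>i. Q i \<omega> = k}"

lemma cover_subset: "cover m \<omega> \<subseteq> {2..Suc m}"
  by (auto simp: cover_def)

lemma finite_cover [simp]: "finite (cover m \<omega>)"
  by (rule finite_subset[OF cover_subset]) simp

lemma cover_subset_ge_2: "cover m \<omega> \<subseteq> {2..}"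
  by (auto simp: cover_def)

lemma cover_Suc:
  "cover (Suc m) \<omega> = (if \<exists>i. Q i \<omega> = m + 2 then insert (m + 2) (cover m \<omega>) else cover m \<omega>)"
  by (auto simp: cover_def le_Suc_eq)

lemma cover_mono: "m \<le> n \<Longrightarrow> cover m \<omega> \<subseteq> cover n \<omega>"
  by (auto simp: cover_def)

lemma cover_Int: "i \<le> m \<Longrightarrow> cover m \<omega> \<inter> {..Suc i} = cover i \<omega>"
  by (auto simp: cover_def)

lemma cover_eq_set_measurable [measurable]: "Measurable.pred M (\<lambda>\<omega>. cover m \<omega> = S)"
proof -
  have "cover m \<omega> = S \<longleftrightarrow> S \<subseteq> {2..Suc m} \<and> (\<forall>k\<in>{2..Suc m}. k \<in> S \<longleftrightarrow> (\<exists>i. Q i \<omega> = k))" for \<omega>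
    by (auto simp: cover_def)
  then show ?thesis by simp
qed

lemma cover_measurable [measurable]: "cover m \<in> measurable M (count_space UNIV)"
proof -
  have "cover m \<in> measurable M (count_space (Pow {2..Suc m}))"
  proof (subst measurable_count_space_eq2)
    show "cover m \<in> space M \<rightarrow> Pow {2..Suc m} \<and> (\<forall>S\<in>Pow {2..Suc m}. cover m -` {S} \<inter> space M \<in> sets M)"
    proof (intro conjI ballI)
      fix S
      have "{\<omega> \<in> space M. cover m \<omega> = S} \<in> sets M" by measurable
      then show "cover m -` {S} \<inter> space M \<in> sets M"
        by (simp add: vimage_def Int_def conj_commute)
    qed (use cover_subset in auto)
  qed simp
  then show ?thesis by (rule measurable_compose) simp
qed

text \<open>Only finitely many sets can occur, so any function of the hit set is bounded.\<close>

lemma integrable_cover [simp]: "integrable M (\<lambda>\<omega>. f (cover m \<omega>) :: real)"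
proof (rule integrable_const_bound)
  show "AE \<omega> in M. norm (f (cover m \<omega>)) \<le> (\<Sum>S\<in>Pow {2..Suc m}. \<bar>f S\<bar>)"
    unfolding real_norm_def
    by (intro AE_I2 member_le_sum[of _ _ "\<lambda>S. \<bar>f S\<bar>"]) (use cover_subset in auto)
qed (rule measurable_compose[OF cover_measurable], simp)

lemma cover_regular:
  assumes "regular \<omega>"
  shows "cover m \<omega> = (\<lambda>i. Q i \<omega>) ` {i. Q i \<omega> \<le> Suc m}"
proof -
  have "2 \<le> Q i \<omega>" for i
    using assms strict_mono_less_eq[of "\<lambda>i. Q i \<omega>" 0 i] by (simp add: regular_def)
  then show ?thesis by (auto simp: cover_def)
qed

text \<open>This is memorylessness. With \<open>p = gap_prob S\<close> and \<open>L\<close> integers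
  missed since the last hit, the hit set equals \<open>S\<close> with the history probability times
  \<open>(1 - p) ^ L\<close>; hitting \<open>m + 2\<close> as well means a gap of
  \<open>L + 1\<close>, which contributes one more factor \<open>p\<close>.\<close>

lemma prob_cover_hit:
  "\<P>(\<omega> in M. cover m \<omega> = S \<and> (\<exists>i. Q i \<omega> = m + 2)) = gap_prob S * \<P>(\<omega> in M. cover m \<omega> = S)"
\<comment> \<open>A set realised by no regular path gives null events on both sides; otherwise such
  a path supplies the history \<open>a\<close>.\<close>
proof (cases "\<exists>\<omega>. regular \<omega> \<and> cover m \<omega> = S")
  case False
  then have "AE \<omega> in M. cover m \<omega> \<noteq> S" using AE_regular by auto
  then have "\<P>(\<omega> in M. cover m \<omega> = S \<and> (\<exists>i. Q i \<omega> = m + 2)) = 0" "\<P>(\<omega> in M. cover m \<omega> = S) = 0"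
    by (auto simp: prob_eq_0)
  then show ?thesis by simp
next
  case True
  then obtain \<omega>' where reg': "regular \<omega>'" and S: "cover m \<omega>' = S" by blast
  define a where "a k = Q k \<omega>'" for k
  have a: "strict_mono a" "a 0 = 2" using reg' by (simp_all add: regular_def a_def[abs_def])
  obtain N where N: "{i. a i \<le> Suc m} = {..<N}" using strict_mono_le_set_eq_lessThan[OF a(1)] ..
  have Sa: "S = a ` {i. a i \<le> Suc m}" using S cover_regular[OF reg', of m] by (simp add: a_def)
  have cover_iff: "cover m \<omega> = S \<longleftrightarrow> (\<forall>k<N. Q k \<omega> = a k) \<and> Suc m < Q N \<omega>" if "regular \<omega>" for \<omega>
    unfolding cover_regular[OF that] Sa
    using that by (intro strict_mono_image_eq_iff a N) (simp add: regular_def)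
  show ?thesis
  proof (cases N)
    case 0
    \<comment> \<open>Having no hits forces \<open>m = 0\<close>, as the first hit is 2. The integer
      examined next is 2 itself, hit almost surely, in agreement with
      \<open>gap_prob {} = 1\<close>.\<close>
    with N have "\<not> a 0 \<le> Suc m" by blast
    with a have "m = 0" by simp
    have "S = {}" using Sa N 0 by simp
    have c: "cover m \<omega> = S" for \<omega> using \<open>m = 0\<close> \<open>S = {}\<close> cover_subset[of 0 \<omega>] by auto
    have "AE \<omega> in M. \<exists>i. Q i \<omega> = m + 2"
      using AE_Q_0 by eventually_elim (auto simp: \<open>m = 0\<close> intro: exI[of _ 0])
    then have "\<P>(\<omega> in M. \<exists>i. Q i \<omega> = m + 2) = 1" by (subst prob_eq_1) auto
    then show ?thesis using \<open>S = {}\<close> by (simp add: c gap_prob_def prob_space)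
  next
    case (Suc n)
    have an: "a n \<le> Suc m" using N Suc by auto
    define L where "L = Suc m - a n"
    have mono: "strict_mono_on {..n} a" using a by (auto simp: strict_mono_on_def strict_mono_def)
    have hist: "(\<forall>k<N. Q k \<omega> = a k) \<longleftrightarrow> history n a \<omega>" for \<omega>
      using Suc by (auto simp: history_def less_Suc_eq_le)
    have "\<P>(\<omega> in M. cover m \<omega> = S) =
      \<P>(\<omega> in M. history n a \<omega> \<and> \<not> (a n < Q (Suc n) \<omega> \<and> Q (Suc n) \<omega> \<le> a n + L))"
    proof (rule finite_measure_eq_AE)
      show "AE \<omega> in M. \<omega> \<in> {\<omega> \<in> space M. cover m \<omega> = S} \<longleftrightarrow> \<omega> \<in> {\<omega> \<in> space M.
        history n a \<omega> \<and> \<not> (a n < Q (Suc n) \<omega> \<and> Q (Suc n) \<omega> \<le> a n + L)}"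
        using AE_regular
      proof eventually_elim
        case (elim \<omega>)
        then have "Q n \<omega> < Q (Suc n) \<omega>" by (simp add: regular_def strict_mono_Suc_iff)
        moreover have "history n a \<omega> \<Longrightarrow> Q n \<omega> = a n" by (simp add: history_def)
        ultimately show ?case using cover_iff[OF elim] hist[of \<omega>] Suc an by (auto simp: L_def)
      qed
    qed measurable
    also have "\<dots> = \<P>(\<omega> in M. history n a \<omega>) * (1 - gap_prob (a ` {..n})) ^ L"
      by (rule prob_history_tail[OF mono])
    finally have 1: "\<P>(\<omega> in M. cover m \<omega> = S) =
      \<P>(\<omega> in M. history n a \<omega>) * (1 - gap_prob (a ` {..n})) ^ L" .
    have "\<P>(\<omega> in M. cover m \<omega> = S \<and> (\<exists>i. Q i \<omega> = m + 2)) =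
      \<P>(\<omega> in M. history n a \<omega> \<and> Q (Suc n) \<omega> = a n + Suc L)"
    proof (rule finite_measure_eq_AE)
      show "AE \<omega> in M. \<omega> \<in> {\<omega> \<in> space M. cover m \<omega> = S \<and> (\<exists>i. Q i \<omega> = m + 2)} \<longleftrightarrow>
        \<omega> \<in> {\<omega> \<in> space M. history n a \<omega> \<and> Q (Suc n) \<omega> = a n + Suc L}"
        using AE_regular
      proof eventually_elim
        case (elim \<omega>)
        \<comment> \<open>An index hitting \<open>m + 2\<close> must come after \<open>n\<close>, so
          monotonicity squeezes the next term between \<open>m + 1\<close> and
          \<open>m + 2\<close>.\<close>
        have "Q (Suc n) \<omega> = m + 2" if h: "history n a \<omega>" "Suc m < Q (Suc n) \<omega>" "Q i \<omega> = m + 2" for i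
        proof -
          have smono: "strict_mono (\<lambda>i. Q i \<omega>)" using elim by (simp add: regular_def)
          have "Q n \<omega> < Q i \<omega>" using h an by (simp add: history_def)
          then have "Suc n \<le> i" using strict_mono_less[OF smono] by simp
          then have "Q (Suc n) \<omega> \<le> Q i \<omega>" using strict_mono_less_eq[OF smono] by simp
          with h show ?thesis by simp
        qed
        then show ?case using cover_iff[OF elim] hist[of \<omega>] Suc an by (auto simp: L_def)
      qed
    qed measurable
    also have "\<dots> = gap_prob (a ` {..n}) * \<P>(\<omega> in M. cover m \<omega> = S)"
      unfolding 1 using prob_history_next[OF mono, of "Suc L"] by simp
    also have "a ` {..n} = S" using Sa N Suc by (simp add: lessThan_Suc_atMost)
    finally show ?thesis .
  qed
qed

text \<open>The one-step transition of the sieve, obtained by splitting over the finitely many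
  values of the hit set; it takes the place of conditional expectations in all moment
  computations.\<close>

lemma expectation_cover_Suc:
  fixes f :: "nat set \<Rightarrow> real"
  shows "(\<integral>\<omega>. f (cover (Suc m) \<omega>) \<partial>M) =
    (\<integral>\<omega>. gap_prob (cover m \<omega>) * f (insert (m + 2) (cover m \<omega>)) +
      (1 - gap_prob (cover m \<omega>)) * f (cover m \<omega>) \<partial>M)"
proof -
  let ?S = "Pow {2..Suc m}"
  let ?B = "\<lambda>S. {\<omega> \<in> space M. cover m \<omega> = S}"
  let ?H = "\<lambda>S. {\<omega> \<in> space M. cover m \<omega> = S \<and> (\<exists>i. Q i \<omega> = m + 2)}"
  have mem: "cover m \<omega> \<in> ?S" for \<omega> using cover_subset by simp
  have B: "(\<Sum>S\<in>?S. h S * indicator (?B S) \<omega>) = h (cover m \<omega>)" if "\<omega> \<in> space M" for h :: "nat set \<Rightarrow> real" and \<omega>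
  proof -
    have "(\<Sum>S\<in>?S. h S * indicator (?B S) \<omega>) = (\<Sum>S\<in>?S. if cover m \<omega> = S then h S else 0)"
      using that by (intro sum.cong) (auto simp: indicator_def)
    then show ?thesis using mem by simp
  qed
  have H: "(\<Sum>S\<in>?S. h S * indicator (?H S) \<omega>) = (if \<exists>i. Q i \<omega> = m + 2 then h (cover m \<omega>) else 0)"
    if "\<omega> \<in> space M" for h :: "nat set \<Rightarrow> real" and \<omega>
  proof -
    have "(\<Sum>S\<in>?S. h S * indicator (?H S) \<omega>) =
      (\<Sum>S\<in>?S. if cover m \<omega> = S then (if \<exists>i. Q i \<omega> = m + 2 then h S else 0) else 0)"
      using that by (intro sum.cong) (auto simp: indicator_def)
    then show ?thesis using mem by simp
  qed
  have int: "(\<integral>\<omega>. (\<Sum>S\<in>?S. h S * indicator (A S) \<omega>) \<partial>M) = (\<Sum>S\<in>?S. h S * prob (A S))"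
    "integrable M (\<lambda>\<omega>. (\<Sum>S\<in>?S. h S * indicator (A S) \<omega>))"
    if "\<And>S. A S \<in> sets M" for h :: "nat set \<Rightarrow> real" and A
  proof -
    have i: "integrable M (\<lambda>\<omega>. h S * indicator (A S) \<omega>)" for S
      using that by (intro integrable_mult_right integrable_real_indicator) (auto simp: emeasure_eq_measure)
    then show "integrable M (\<lambda>\<omega>. (\<Sum>S\<in>?S. h S * indicator (A S) \<omega>))" by (rule Bochner_Integration.integrable_sum)
    have "(\<integral>\<omega>. (\<Sum>S\<in>?S. h S * indicator (A S) \<omega>) \<partial>M) = (\<Sum>S\<in>?S. \<integral>\<omega>. h S * indicator (A S) \<omega> \<partial>M)"
      using i by (rule Bochner_Integration.integral_sum)
    also have "\<dots> = (\<Sum>S\<in>?S. h S * prob (A S))"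
      using that by (intro sum.cong refl) (simp add: sets.Int_space_eq2)
    finally show "(\<integral>\<omega>. (\<Sum>S\<in>?S. h S * indicator (A S) \<omega>) \<partial>M) = (\<Sum>S\<in>?S. h S * prob (A S))" .
  qed
  have sets_H: "?H S \<in> sets M" and sets_B: "?B S \<in> sets M" for S by measurable
  \<comment> \<open>The change of \<open>f\<close> caused by a hit.\<close>
  let ?d = "\<lambda>S. f (insert (m + 2) S) - f S"
  have "(\<integral>\<omega>. f (cover (Suc m) \<omega>) \<partial>M) =
    (\<integral>\<omega>. (\<Sum>S\<in>?S. ?d S * indicator (?H S) \<omega>) + (\<Sum>S\<in>?S. f S * indicator (?B S) \<omega>) \<partial>M)"
    by (intro Bochner_Integration.integral_cong refl) (simp only: B H cover_Suc, simp)
  also have "\<dots> = (\<Sum>S\<in>?S. ?d S * prob (?H S)) + (\<Sum>S\<in>?S. f S * prob (?B S))"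
    by (simp only: Bochner_Integration.integral_add int[of ?H, OF sets_H] int[of ?B, OF sets_B])
  also have "\<dots> = (\<Sum>S\<in>?S. (gap_prob S * f (insert (m + 2) S) + (1 - gap_prob S) * f S) * prob (?B S))"
    unfolding prob_cover_hit by (simp add: sum.distrib[symmetric] algebra_simps)
  also have "\<dots> = (\<integral>\<omega>. (\<Sum>S\<in>?S. (gap_prob S * f (insert (m + 2) S) + (1 - gap_prob S) * f S) *
      indicator (?B S) \<omega>) \<partial>M)"
    by (rule int(1)[symmetric]) (rule sets_B)
  also have "\<dots> = (\<integral>\<omega>. gap_prob (cover m \<omega>) * f (insert (m + 2) (cover m \<omega>)) +
      (1 - gap_prob (cover m \<omega>)) * f (cover m \<omega>) \<partial>M)"
    by (intro Bochner_Integration.integral_cong refl) (simp only: B)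
  finally show ?thesis .
qed

section \<open>Second moments and almost sure limits\<close>

lemma gap_prob_cover_pos [simp]: "0 < gap_prob (cover m \<omega>)"
  by (intro gap_prob_pos cover_subset_ge_2)

lemma gap_prob_cover_le_1 [simp]: "gap_prob (cover m \<omega>) \<le> 1"
  by (intro gap_prob_le_1 cover_subset_ge_2)

lemma not_mem_cover [simp]: "Suc (Suc m) \<notin> cover m \<omega>"
  by (auto simp: cover_def)

lemma inverse_gap_prob_insert_cover:
  "1 / gap_prob (insert (m + 2) (cover m \<omega>)) =
    1 / gap_prob (cover m \<omega>) * (1 + inverse (real (Suc m)))"
  by (subst gap_prob_insert) (auto simp: field_simps)

text \<open>A hit has probability \<open>x\<close> and raises \<open>1 / x\<close> by
  \<open>1 / x\<close> times \<open>1 / (m + 1)\<close>, so the mean increment is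
  \<open>1 / (m + 1)\<close> whatever the state.\<close>

lemma expectation_inverse_gap_prob:
  "(\<integral>\<omega>. 1 / gap_prob (cover m \<omega>) \<partial>M) = 1 + harm m"
proof (induction m)
  case 0
  have "cover 0 \<omega> = {}" for \<omega> using cover_subset[of 0 \<omega>] by auto
  then show ?case by (simp add: gap_prob_def harm_expand prob_space)
next
  case (Suc m)
  have *: "x * (1 / x * (1 + t)) + (1 - x) * (1 / x) = 1 / x + t" if "0 < x" for x t :: real
    using that by (simp add: field_simps)
  have "(\<integral>\<omega>. 1 / gap_prob (cover (Suc m) \<omega>) \<partial>M) =
    (\<integral>\<omega>. 1 / gap_prob (cover m \<omega>) + inverse (real (Suc m)) \<partial>M)"
    unfolding expectation_cover_Suc[of "\<lambda>S. 1 / gap_prob S"] inverse_gap_prob_insert_cover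
    by (simp only: * gap_prob_cover_pos)
  also have "\<dots> = 1 + harm (Suc m)"
    using Suc by (subst Bochner_Integration.integral_add)
      (simp_all add: integrable_cover[of "\<lambda>S. 1 / gap_prob S"] prob_space harm_Suc)
  finally show ?case .
qed

text \<open>The bound telescopes: \<open>(1 + harm m) / (m + 1)\<close> decreases by \<open>harm m / ((m + 1) * (m + 2))\<close>.\<close>

lemma variance_inverse_gap_prob_le:
  "(\<integral>\<omega>. (1 / gap_prob (cover m \<omega>) - (1 + harm m))\<^sup>2 \<partial>M) \<le> 2 * (1 - (1 + harm m) / real (Suc m))"
proof (induction m)
  case 0
  have "cover 0 \<omega> = {}" for \<omega> using cover_subset[of 0 \<omega>] by auto
  then show ?case by (simp add: gap_prob_def harm_expand)
next
  case (Suc m)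
  define t where "t = inverse (real (Suc m))"
  define h :: real where "h = 1 + harm m"
  \<comment> \<open>The cross term cancels by the martingale property;
    \<open>t\<^sup>2 * (1 / x - 1)\<close> is the conditional variance of the step, with mean
    \<open>t\<^sup>2 * harm m\<close>.\<close>
  have *: "x * (1 / x * (1 + t) - (h + t))\<^sup>2 + (1 - x) * (1 / x - (h + t))\<^sup>2 =
      (1 / x - h)\<^sup>2 + t\<^sup>2 * (1 / x - 1)" if "0 < x" for x
    using that by (simp add: field_simps power2_eq_square)
  have "(\<integral>\<omega>. (1 / gap_prob (cover (Suc m) \<omega>) - (1 + harm (Suc m)))\<^sup>2 \<partial>M) =
    (\<integral>\<omega>. (1 / gap_prob (cover (Suc m) \<omega>) - (h + t))\<^sup>2 \<partial>M)"
    by (simp add: h_def t_def harm_Suc add_ac)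
  also have "\<dots> = (\<integral>\<omega>. (1 / gap_prob (cover m \<omega>) - h)\<^sup>2 + t\<^sup>2 * (1 / gap_prob (cover m \<omega>) - 1) \<partial>M)"
    unfolding expectation_cover_Suc[of "\<lambda>S. (1 / gap_prob S - (h + t))\<^sup>2"]
      inverse_gap_prob_insert_cover t_def[symmetric]
    by (simp only: * gap_prob_cover_pos)
  also have "\<dots> = (\<integral>\<omega>. (1 / gap_prob (cover m \<omega>) - h)\<^sup>2 \<partial>M) + t\<^sup>2 * harm m"
    by (subst Bochner_Integration.integral_add)
      (simp_all add: integrable_cover[of "\<lambda>S. (1 / gap_prob S - h)\<^sup>2"]
        integrable_cover[of "\<lambda>S. t\<^sup>2 * (1 / gap_prob S - 1)"] integrable_cover[of "\<lambda>S. 1 / gap_prob S"]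
        expectation_inverse_gap_prob prob_space)
  also have "\<dots> \<le> 2 * (1 - h / real (Suc m)) + t\<^sup>2 * harm m"
    using Suc by (simp add: h_def)
  also have "\<dots> \<le> 2 * (1 - (h + t) / real (Suc (Suc m)))"
  proof -
    have "t\<^sup>2 * harm m \<le> 2 * harm m / (real (Suc m) * real (Suc (Suc m)))"
    proof -
      \<comment> \<open>The factor 2 comes from \<open>m + 2 \<le> 2 * (m + 1)\<close> and turns the
        square into a telescoping denominator.\<close>
      have "t\<^sup>2 \<le> 2 / (real (Suc m) * real (Suc (Suc m)))"
      proof -
        have "real (Suc m) * real (Suc (Suc m)) \<le> 2 * (real (Suc m))\<^sup>2"
          by (simp add: power2_eq_square algebra_simps)
        then have "2 / (2 * (real (Suc m))\<^sup>2) \<le> 2 / (real (Suc m) * real (Suc (Suc m)))"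
          by (intro divide_left_mono) auto
        then show ?thesis by (simp add: t_def inverse_eq_divide power_one_over)
      qed
      then have "t\<^sup>2 * harm m \<le> 2 / (real (Suc m) * real (Suc (Suc m))) * harm m"
        by (intro mult_right_mono harm_nonneg)
      then show ?thesis by simp
    qed
    also have "\<dots> = 2 * (h / real (Suc m) - (h + t) / real (Suc (Suc m)))"
    proof -
      have "2 * H / (s * (s + 1)) = 2 * ((1 + H) / s - (1 + H + inverse s) / (s + 1))"
        if "0 < s" for s H :: real
        using that by (simp add: divide_simps) (simp add: algebra_simps)
      from this[of "real (Suc m)" "harm m"] show ?thesis by (simp add: h_def t_def add_ac)
    qed
    finally show ?thesis by simp
  qed
  finally show ?case by (simp add: h_def t_def harm_Suc add_ac)
qed

section \<open>Fluctuations of the number of hits\<close>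

definition compensated_count :: "nat \<Rightarrow> 'a \<Rightarrow> real" where
  "compensated_count m \<omega> = real (card (cover m \<omega>)) - (\<Sum>i<m. gap_prob (cover i \<omega>))"

text \<open>Earlier hit sets are recovered from the current one, so the compensated count is a
  function of a single set, as \<open>integrable_cover\<close> and
  \<open>expectation_cover_Suc\<close> require.\<close>

lemma compensated_count_eq:
  "compensated_count m \<omega> =
    real (card (cover m \<omega>)) - (\<Sum>i<m. gap_prob (cover m \<omega> \<inter> {..Suc i}))"
  by (simp add: compensated_count_def cover_Int)

lemma integrable_compensated_count: "integrable M (\<lambda>\<omega>. (compensated_count m \<omega>)\<^sup>2)"
  unfolding compensated_count_eq
  by (rule integrable_cover[of "\<lambda>S. (real (card S) - (\<Sum>i<m. gap_prob (S \<inter> {..Suc i})))\<^sup>2"])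

text \<open>Each step adds the mean of the Bernoulli variance \<open>x * (1 - x)\<close>, which is
  at most 1.\<close>

lemma second_moment_compensated_count_le:
  "(\<integral>\<omega>. (compensated_count m \<omega>)\<^sup>2 \<partial>M) \<le> real m"
proof (induction m)
  case 0
  have "cover 0 \<omega> = {}" for \<omega> using cover_subset[of 0 \<omega>] by auto
  then show ?case by (simp add: compensated_count_def)
next
  case (Suc m)
  let ?f = "\<lambda>S. real (card S) - (\<Sum>i<Suc m. gap_prob (S \<inter> {..Suc i}))"
  \<comment> \<open>Inserting \<open>m + 2\<close> leaves all the truncations up to
    \<open>Suc i\<close> with \<open>i \<le> m\<close> unchanged.\<close>
  have hit: "?f (insert (m + 2) (cover m \<omega>)) = compensated_count m \<omega> + (1 - gap_prob (cover m \<omega>))" for \<omega>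
    by (simp add: compensated_count_def cover_Int)
  have miss: "?f (cover m \<omega>) = compensated_count m \<omega> - gap_prob (cover m \<omega>)" for \<omega>
    by (simp add: compensated_count_def cover_Int)
  have *: "x * (d + (1 - x))\<^sup>2 + (1 - x) * (d - x)\<^sup>2 = d\<^sup>2 + x * (1 - x)" for x d :: real
    by (simp add: field_simps power2_eq_square)
  have "(\<integral>\<omega>. (compensated_count (Suc m) \<omega>)\<^sup>2 \<partial>M) = (\<integral>\<omega>. (?f (cover (Suc m) \<omega>))\<^sup>2 \<partial>M)"
    by (simp only: compensated_count_eq)
  also have "\<dots> = (\<integral>\<omega>. (compensated_count m \<omega>)\<^sup>2 + gap_prob (cover m \<omega>) * (1 - gap_prob (cover m \<omega>)) \<partial>M)"
    unfolding expectation_cover_Suc[of "\<lambda>S. (?f S)\<^sup>2"] hit miss * ..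
  also have "\<dots> \<le> (\<integral>\<omega>. (compensated_count m \<omega>)\<^sup>2 + 1 \<partial>M)"
  proof (rule integral_mono)
    show "integrable M (\<lambda>\<omega>. (compensated_count m \<omega>)\<^sup>2 + gap_prob (cover m \<omega>) * (1 - gap_prob (cover m \<omega>)))"
      by (intro Bochner_Integration.integrable_add integrable_compensated_count
        integrable_cover[of "\<lambda>S. gap_prob S * (1 - gap_prob S)"])
    show "integrable M (\<lambda>\<omega>. (compensated_count m \<omega>)\<^sup>2 + 1)"
      by (intro Bochner_Integration.integrable_add integrable_compensated_count) simp
    fix \<omega>
    have "gap_prob (cover m \<omega>) * (1 - gap_prob (cover m \<omega>)) \<le> 1 * 1"
      by (intro mult_mono) (auto intro: less_imp_le)
    then show "(compensated_count m \<omega>)\<^sup>2 + gap_prob (cover m \<omega>) * (1 - gap_prob (cover m \<omega>))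
        \<le> (compensated_count m \<omega>)\<^sup>2 + 1" by simp
  qed
  also have "\<dots> = (\<integral>\<omega>. (compensated_count m \<omega>)\<^sup>2 \<partial>M) + 1"
    by (subst Bochner_Integration.integral_add) (simp_all add: integrable_compensated_count prob_space)
  finally show ?case using Suc by simp
qed

text \<open>The variance stays below 2 while the mean at \<open>2 ^ k\<close> is at least
  \<open>k * ln 2\<close>, so the relative second moments are of order
  \<open>1 / k ^ 2\<close>.\<close>

lemma AE_inverse_gap_prob_subseq:
  "AE \<omega> in M. (\<lambda>k. 1 / gap_prob (cover (2 ^ k) \<omega>) / (1 + harm (2 ^ k))) \<longlonglongrightarrow> 1"
proof -
  define h :: "nat \<Rightarrow> real" where "h m = 1 + harm m" for m
  have hpos: "0 < h m" for m using harm_nonneg[of m, where 'a = real] unfolding h_def by linarith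
  have "AE \<omega> in M. (\<lambda>k. (1 / gap_prob (cover (2 ^ k) \<omega>) - h (2 ^ k)) / h (2 ^ k)) \<longlonglongrightarrow> 0"
  proof (rule AE_tendsto_0_of_summable_integral_square)
    fix k
    show "integrable M (\<lambda>\<omega>. ((1 / gap_prob (cover (2 ^ k) \<omega>) - h (2 ^ k)) / h (2 ^ k))\<^sup>2)"
      by (rule integrable_cover[of "\<lambda>S. ((1 / gap_prob S - h (2 ^ k)) / h (2 ^ k))\<^sup>2"])
    have "(\<integral>\<omega>. ((1 / gap_prob (cover (2 ^ k) \<omega>) - h (2 ^ k)) / h (2 ^ k))\<^sup>2 \<partial>M) =
      (\<integral>\<omega>. (1 / gap_prob (cover (2 ^ k) \<omega>) - h (2 ^ k))\<^sup>2 \<partial>M) / (h (2 ^ k))\<^sup>2"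
      by (simp add: power_divide)
    also have "\<dots> \<le> 2 / (h (2 ^ k))\<^sup>2"
    proof (rule divide_right_mono)
      have "0 \<le> h (2 ^ k) / real (Suc (2 ^ k))" using hpos[of "2 ^ k"] by simp
      then have "2 * (1 - h (2 ^ k) / real (Suc (2 ^ k))) \<le> 2" by simp
      with variance_inverse_gap_prob_le[of "2 ^ k", folded h_def]
      show "(\<integral>\<omega>. (1 / gap_prob (cover (2 ^ k) \<omega>) - h (2 ^ k))\<^sup>2 \<partial>M) \<le> 2" by (rule order_trans)
    qed simp
    finally show "(\<integral>\<omega>. ((1 / gap_prob (cover (2 ^ k) \<omega>) - h (2 ^ k)) / h (2 ^ k))\<^sup>2 \<partial>M) \<le> 2 / (h (2 ^ k))\<^sup>2" .
  next
    show "summable (\<lambda>k. 2 / (h (2 ^ k))\<^sup>2)"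
    proof (rule summable_comparison_test')
      show "summable (\<lambda>k. 2 / (ln 2)\<^sup>2 * inverse (real k ^ 2))"
        by (intro summable_mult inverse_power_summable) simp
      \<comment> \<open>The comparison starts at 1: at \<open>k = 0\<close> the majorant is 0, by
        the convention for \<open>inverse 0\<close>, while the term is positive.\<close>
      fix k :: nat assume k: "1 \<le> k"
      have "real k * ln 2 = ln (2 ^ k)" by (simp add: ln_realpow)
      also have "\<dots> \<le> ln (real (2 ^ k) + 1)" by (subst ln_le_cancel_iff) (auto intro: add_pos_pos)
      also have "\<dots> \<le> h (2 ^ k)" using ln_le_harm[of "2 ^ k"] by (simp add: h_def)
      finally have "(real k * ln 2)\<^sup>2 \<le> (h (2 ^ k))\<^sup>2" by (intro power_mono) auto
      then have "2 / (h (2 ^ k))\<^sup>2 \<le> 2 / (real k * ln 2)\<^sup>2"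
        using k hpos[of "2 ^ k"] by (intro divide_left_mono mult_pos_pos) auto
      then show "norm (2 / (h (2 ^ k))\<^sup>2) \<le> 2 / (ln 2)\<^sup>2 * inverse (real k ^ 2)"
        by (simp add: power_mult_distrib field_simps)
    qed
  qed
  then show ?thesis
  proof eventually_elim
    case (elim \<omega>)
    then have "(\<lambda>k. (1 / gap_prob (cover (2 ^ k) \<omega>) - h (2 ^ k)) / h (2 ^ k) + 1) \<longlonglongrightarrow> 0 + 1"
      by (intro tendsto_intros)
    moreover have "(1 / gap_prob (cover (2 ^ k) \<omega>) - h (2 ^ k)) / h (2 ^ k) + 1 =
        1 / gap_prob (cover (2 ^ k) \<omega>) / h (2 ^ k)" for k
      using hpos[of "2 ^ k"] by (simp add: diff_divide_distrib)
    ultimately show ?case by (simp only: h_def add_0)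
  qed
qed

text \<open>At time \<open>k ^ 4\<close> the second moment is at most \<open>k ^ 4\<close>; dividing
  by \<open>k ^ 6\<close> leaves the summable \<open>1 / k ^ 2\<close>.\<close>

lemma AE_compensated_count_subseq:
  "AE \<omega> in M. (\<lambda>k. compensated_count (k ^ 4) \<omega> / real k ^ 3) \<longlonglongrightarrow> 0"
proof (rule AE_tendsto_0_of_summable_integral_square)
  fix k
  show "integrable M (\<lambda>\<omega>. (compensated_count (k ^ 4) \<omega> / real k ^ 3)\<^sup>2)"
    by (simp add: power_divide integrable_compensated_count)
  have "(\<integral>\<omega>. (compensated_count (k ^ 4) \<omega> / real k ^ 3)\<^sup>2 \<partial>M) \<le> real (k ^ 4) / (real k ^ 3)\<^sup>2"
    using second_moment_compensated_count_le[of "k ^ 4"] by (simp add: power_divide divide_right_mono)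
  also have "\<dots> = inverse (real k ^ 2)"
    by (cases "k = 0") (simp_all add: field_simps flip: power_mult power_add)
  finally show "(\<integral>\<omega>. (compensated_count (k ^ 4) \<omega> / real k ^ 3)\<^sup>2 \<partial>M) \<le> inverse (real k ^ 2)" .
qed (simp add: inverse_power_summable)

section \<open>From the counting function to the hit points\<close>

lemma card_cover_hit:
  assumes "regular \<omega>"
  shows "card (cover (Q n \<omega> - 1) \<omega>) = Suc n"
proof -
  have mono: "strict_mono (\<lambda>i. Q i \<omega>)" and "Q 0 \<omega> = 2" using assms by (auto simp: regular_def)
  then have "Q n \<omega> \<ge> 2" using strict_mono_less_eq[OF mono, of 0 n] by simp
  then have "cover (Q n \<omega> - 1) \<omega> = (\<lambda>i. Q i \<omega>) ` {..n}"
    using strict_mono_less_eq[OF mono] by (subst cover_regular[OF assms]) auto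
  then show ?thesis
    using strict_mono_imp_inj_on[OF mono] by (simp add: card_image inj_on_subset[OF _ subset_UNIV])
qed

text \<open>The pathwise part: only real analysis on one regular path satisfying both subsequence
  limits.\<close>

lemma P_asymp:
  assumes reg: "regular \<omega>"
    and Y: "(\<lambda>k. 1 / gap_prob (cover (2 ^ k) \<omega>) / (1 + harm (2 ^ k))) \<longlonglongrightarrow> 1"
    and D: "(\<lambda>k. compensated_count (k ^ 4) \<omega> / real k ^ 3) \<longlonglongrightarrow> 0"
  shows "(\<lambda>n. real (P n \<omega>) / (real n * ln (real n))) \<longlonglongrightarrow> 1"
proof -
  define g where "g n = real n / ln (real n)" for n :: nat
  note g = div_ln_asymp[folded g_def]
  define A where "A m = (\<Sum>i<m. gap_prob (cover i \<omega>))" for m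

  \<comment> \<open>Powers of 2 suffice for interpolation because consecutive logarithms have ratio
    \<open>(k + 1) / k\<close>.\<close>
  have Y_ln: "(\<lambda>m. 1 / gap_prob (cover m \<omega>) / ln (real m)) \<longlonglongrightarrow> 1"
  proof (rule mono_ratio_tendsto_1_of_subseq)
    show "mono (\<lambda>m. 1 / gap_prob (cover m \<omega>))"
      by (intro monoI frac_le gap_prob_antimono cover_mono cover_subset_ge_2) auto
    show "0 \<le> 1 / gap_prob (cover m \<omega>)" for m by (simp add: less_imp_le)
    show "\<forall>\<^sub>F n in sequentially. 0 < ln (real n) \<and> ln (real n) \<le> ln (real (Suc n))"
      using eventually_gt_at_top[of 1] by eventually_elim auto
    show "strict_mono (\<lambda>k. 2 ^ k :: nat)" by (simp add: strict_mono_Suc_iff)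
    have "filterlim (\<lambda>k. 2 ^ k :: nat) at_top sequentially"
      by (rule filterlim_subseq) (simp add: strict_mono_Suc_iff)
    from filterlim_compose[OF harm_asymp_ln this]
    have "(\<lambda>k. 1 / gap_prob (cover (2 ^ k) \<omega>) / (1 + harm (2 ^ k)) *
        ((1 + harm (2 ^ k)) / ln (real (2 ^ k)))) \<longlonglongrightarrow> 1 * 1"
      by (intro tendsto_mult Y)
    moreover have "1 + harm (2 ^ k) \<noteq> (0::real)" for k
      using harm_nonneg[of "2 ^ k", where 'a = real] by linarith
    ultimately show "(\<lambda>k. 1 / gap_prob (cover (2 ^ k) \<omega>) / ln (real (2 ^ k))) \<longlonglongrightarrow> 1"
      by simp
    show "(\<lambda>k. ln (real (2 ^ Suc k)) / ln (real (2 ^ k))) \<longlonglongrightarrow> 1"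
      unfolding of_nat_power of_nat_numeral power_Suc by real_asymp
  qed

  \<comment> \<open>The increments of \<open>A\<close> and of \<open>g\<close> are both asymptotic
    to \<open>1 / ln m\<close>, so their ratio tends to 1.\<close>
  have A: "(\<lambda>m. A m / g m) \<longlonglongrightarrow> 1"
  proof (rule stolz_cesaro[OF g(1) g(3)])
    have "(\<lambda>m. 1 / (1 / gap_prob (cover m \<omega>) / ln (real m) *
        (ln (real m) * (g (Suc m) - g m)))) \<longlonglongrightarrow> 1 / (1 * 1)"
      by (intro tendsto_intros Y_ln g(4)) simp
    moreover have "\<forall>\<^sub>F m in sequentially. 1 / (1 / gap_prob (cover m \<omega>) / ln (real m) *
        (ln (real m) * (g (Suc m) - g m))) = (A (Suc m) - A m) / (g (Suc m) - g m)"
      using eventually_gt_at_top[of 1]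
      by eventually_elim (simp add: A_def)
    ultimately show "(\<lambda>m. (A (Suc m) - A m) / (g (Suc m) - g m)) \<longlonglongrightarrow> 1"
      unfolding div_by_1 mult_1_right by (rule Lim_transform_eventually)
  qed

  \<comment> \<open>Powers of 2 would be too sparse here, since \<open>g\<close> asymptotically
    doubles between them; fourth powers keep the ratio near 1.\<close>
  have N: "(\<lambda>m. real (card (cover m \<omega>)) / g m) \<longlonglongrightarrow> 1"
  proof (rule mono_ratio_tendsto_1_of_subseq)
    show "mono (\<lambda>m. real (card (cover m \<omega>)))"
      by (intro monoI of_nat_mono card_mono cover_mono finite_cover)
    show "\<forall>\<^sub>F m in sequentially. 0 < g m \<and> g m \<le> g (Suc m)"
      using g(1,2) by eventually_elim simp
    show s: "strict_mono (\<lambda>k. k ^ 4 :: nat)"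
      by (intro strict_monoI power_strict_mono) auto
    have "(\<lambda>k. compensated_count (k ^ 4) \<omega> / real k ^ 3 * (real k ^ 3 / g (k ^ 4)) +
        A (k ^ 4) / g (k ^ 4)) \<longlonglongrightarrow> 0 * 0 + 1"
      by (intro tendsto_intros D g(6) filterlim_compose[OF A filterlim_subseq[OF s]])
    moreover have "\<forall>\<^sub>F k in sequentially. compensated_count (k ^ 4) \<omega> / real k ^ 3 *
        (real k ^ 3 / g (k ^ 4)) + A (k ^ 4) / g (k ^ 4) = real (card (cover (k ^ 4) \<omega>)) / g (k ^ 4)"
      using eventually_gt_at_top[of 0]
    proof eventually_elim
      case (elim k)
      then have "x / real k ^ 3 * (real k ^ 3 / g (k ^ 4)) = x / g (k ^ 4)" for x by simp
      then show ?case
        by (simp only: compensated_count_def A_def add_divide_distrib[symmetric] diff_add_cancel)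
    qed
    ultimately show "(\<lambda>k. real (card (cover (k ^ 4) \<omega>)) / g (k ^ 4)) \<longlonglongrightarrow> 1"
      unfolding mult_zero_left add_0 by (rule Lim_transform_eventually)
  qed (simp_all add: g(5))

  have mono: "strict_mono (\<lambda>i. Q i \<omega>)" and Q0: "Q 0 \<omega> = 2" using reg by (auto simp: regular_def)
  have Qge: "2 + n \<le> Q n \<omega>" for n
  proof (induction n)
    case (Suc n)
    with mono show ?case by (metis Suc_leI add_Suc_right le_less_trans strict_mono_Suc_iff)
  qed (simp add: Q0)
  have P_eq: "P n \<omega> = Q (n - 1) \<omega>" if "n > 0" for n using that by (simp add: Q_def)
  \<comment> \<open>The window of \<open>cover m\<close> ends at \<open>m + 1\<close>, so the shift
    by one makes it end exactly at the \<open>n\<close>-th hit and contain \<open>n\<close>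
    hits.\<close>
  define q where "q n = P n \<omega> - 1" for n
  have qge: "n \<le> q n" and Pq: "P n \<omega> = q n + 1" if "n > 0" for n
    using Qge[of "n - 1"] that by (auto simp: P_eq q_def)
  have qtop: "filterlim q at_top sequentially"
    unfolding filterlim_at_top
  proof
    fix Z
    show "\<forall>\<^sub>F n in sequentially. Z \<le> q n"
      using eventually_ge_at_top[of Z] eventually_gt_at_top[of 0]
      by eventually_elim (meson order_trans qge)
  qed
  have qtop': "filterlim (\<lambda>n. real (q n)) at_top sequentially"
    by (rule filterlim_compose[OF filterlim_real_sequentially qtop])
  have "\<forall>\<^sub>F n in sequentially. real (card (cover (q n) \<omega>)) / g (q n) = real n * ln (real (q n)) / real (q n)"
    using eventually_gt_at_top[of 0]
  proof eventually_elim
    case (elim n)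
    then show ?case using card_cover_hit[OF reg, of "n - 1"] by (simp add: q_def P_eq g_def)
  qed
  with filterlim_compose[OF N qtop]
  have "(\<lambda>n. real n * ln (real (q n)) / real (q n)) \<longlonglongrightarrow> 1"
    by (rule Lim_transform_eventually)
  then have 1: "(\<lambda>n. real (q n) / (real n * ln (real n))) \<longlonglongrightarrow> 1"
    by (intro asymp_inverse_div_ln qtop')
  \<comment> \<open>The shift between \<open>q\<close> and \<open>P\<close> vanishes after
    normalisation.\<close>
  have "(\<lambda>n. 1 / (real n * ln (real n))) \<longlonglongrightarrow> 0" by real_asymp
  from tendsto_add[OF 1 this]
  have "(\<lambda>n. real (q n) / (real n * ln (real n)) + 1 / (real n * ln (real n))) \<longlonglongrightarrow> 1" by simp
  moreover have "\<forall>\<^sub>F n in sequentially. real (q n) / (real n * ln (real n)) + 1 / (real n * ln (real n)) =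
      real (P n \<omega>) / (real n * ln (real n))"
    using eventually_gt_at_top[of 0] by eventually_elim (simp add: Pq add_divide_distrib)
  ultimately show ?thesis by (rule Lim_transform_eventually)
qed

end

theorem theorem1:
  fixes M :: "'a measure" and P :: "nat \<Rightarrow> 'a \<Rightarrow> nat"
  assumes "renewal_covering M P"
  shows "AE \<omega> in M. (\<lambda>n. real (P n \<omega>) / (real n * ln (real n))) \<longlonglongrightarrow> 1"
proof -
  interpret renewal_covering M P by fact
  from AE_regular AE_inverse_gap_prob_subseq AE_compensated_count_subseq show ?thesis
    by eventually_elim (rule P_asymp)
qed

end
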